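(* Let $\alpha_0,\alpha_1,\alpha_2,\alpha_3$ be complex parameters with $\alpha_0+\alpha_1+2\alpha_2+\alpha_3=1$ and consider the Hamiltonian system $$\frac{dx}{dt}=\frac{\partial H}{\partial y},\quad \frac{dy}{dt}=-\frac{\partial H}{\partial x},\quad \frac{dz}{dt}=\frac{\partial H}{\partial w},\quad \frac{dw}{dt}=-\frac{\partial H}{\partial z}$$ with $$\begin{aligned} t^2H =\;&-tx(x-1)y^2+\{x^2+((\alpha_0+\alpha_1)t-1)x-\alpha_1 t\}y+(\alpha_2+\alpha_3)x-(\alpha_0 t-1)\alpha_1\\ &-\frac{z^2w^4}{4}+\frac{\alpha_3}{2}zw^3+\frac{1}{4}(2tz^2-\alpha_3^2)w^2-\frac{1}{2}\{(\alpha_0+\alpha_1+2\alpha_2+2\alpha_3)t-1\}zw-\frac{t^2 z^2}{4}\\ &-xzw. \end{aligned}$$ This system has the following invariant divisors: $f_0:=x-1$ when $\alpha_0=0$; $f_1:=x$ when $\alpha_1=0$; $f_2:=yw^2-ty+1$ when $\alpha_2=0$; $f_3:=z$ when $\alpha_3=0$.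
   Context: A polynomial $f\in\mathbb{C}(t)[x,y,z,w]$ is an invariant divisor of the system (for given parameter values) if its derivative along the flow, $\frac{\partial f}{\partial t}+\frac{\partial H}{\partial y}\frac{\partial f}{\partial x}-\frac{\partial H}{\partial x}\frac{\partial f}{\partial y}+\frac{\partial H}{\partial w}\frac{\partial f}{\partial z}-\frac{\partial H}{\partial z}\frac{\partial f}{\partial w}$, is divisible by $f$ in $\mathbb{C}(t)[x,y,z,w]$; i.e. the hypersurface $f=0$ is invariant under the system. *)

theory Defs
  imports Complex_Main "HOL-Library.Poly_Mapping" "HOL-Computational_Algebra.Polynomial_Factorial"
begin

(* The derivation d/dt on C(t), by the quotient rule. The result does not depend on the
   representation of q as a quotient, so the description is proper: see fract_deriv_Fract. *)
definition fract_deriv :: "complex poly fract \<Rightarrow> complex poly fract" where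
  "fract_deriv q = (THE r. \<exists>a b. b \<noteq> 0 \<and> q = Fract a b \<and>
     r = Fract (pderiv a * b - a * pderiv b) (b\<^sup>2))"

lemma fract_deriv_Fract:
  assumes "b \<noteq> 0"
  shows "fract_deriv (Fract a b) = Fract (pderiv a * b - a * pderiv b) (b\<^sup>2)"
  unfolding fract_deriv_def
proof (rule the_equality)
  fix r assume "\<exists>c d. d \<noteq> 0 \<and> Fract a b = Fract c d \<and>
    r = Fract (pderiv c * d - c * pderiv d) (d\<^sup>2)"
  then obtain c d where d: "d \<noteq> 0" and "Fract a b = Fract c d"
    and r: "r = Fract (pderiv c * d - c * pderiv d) (d\<^sup>2)" by blast
  then have eq: "a * d = c * b" using assms by (simp add: eq_fract)
  then have "pderiv (a * d) = pderiv (c * b)" by simp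
  then have eq': "a * pderiv d + d * pderiv a = c * pderiv b + b * pderiv c"
    by (simp add: pderiv_mult)
  have "(pderiv a * b - a * pderiv b) * d\<^sup>2 - (pderiv c * d - c * pderiv d) * b\<^sup>2
      = b * d * ((a * pderiv d + d * pderiv a) - (c * pderiv b + b * pderiv c))
        - (a * d - c * b) * (d * pderiv b + b * pderiv d)"
    by (simp add: algebra_simps power2_eq_square)
  also have "\<dots> = 0" using eq eq' by simp
  finally show "r = Fract (pderiv a * b - a * pderiv b) (b\<^sup>2)"
    unfolding r using assms d by (simp add: eq_fract)
qed (use assms in blast)

(* The polynomial ring R[v | v :: 'v]: finitely supported functions from monomials to
   coefficients, a monomial being a finitely supported exponent vector. *)
type_synonym ('v, 'a) mpoly = "('v \<Rightarrow>\<^sub>0 nat) \<Rightarrow>\<^sub>0 'a"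

definition Const :: "'a::zero \<Rightarrow> ('v, 'a) mpoly" where
  "Const c = Poly_Mapping.single 0 c"

definition Indet :: "'v \<Rightarrow> ('v, 'a::zero_neq_one) mpoly" where
  "Indet v = Poly_Mapping.single (Poly_Mapping.single v 1) 1"

(* If v does not occur in the monomial m, then the (truncating) subtraction on exponents
   is harmless, as the coefficient is 0. *)
definition partial_deriv :: "'v \<Rightarrow> ('v, 'a::semiring_1) mpoly \<Rightarrow> ('v, 'a) mpoly" where
  "partial_deriv v p = (\<Sum>m\<in>Poly_Mapping.keys p.
     Poly_Mapping.single (m - Poly_Mapping.single v 1)
       (of_nat (Poly_Mapping.lookup m v) * Poly_Mapping.lookup p m))"

datatype var = VX | VY | VZ | VW

(* C(t) and C(t)[x,y,z,w] *)
type_synonym ratfun = "complex poly fract"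
type_synonym phase_poly = "(var, ratfun) mpoly"

(* The partial derivative with respect to t acts on the coefficients. *)
definition deriv_t :: "phase_poly \<Rightarrow> phase_poly" where
  "deriv_t p = (\<Sum>m\<in>Poly_Mapping.keys p.
     Poly_Mapping.single m (fract_deriv (Poly_Mapping.lookup p m)))"

definition t_fun :: ratfun where
  "t_fun = to_fract [:0, 1:]"

definition cnst :: "complex \<Rightarrow> phase_poly" where
  "cnst a = Const (to_fract [:a:])"

abbreviation pt :: phase_poly where "pt \<equiv> Const t_fun"
abbreviation px :: phase_poly where "px \<equiv> Indet VX"
abbreviation py :: phase_poly where "py \<equiv> Indet VY"
abbreviation pz :: phase_poly where "pz \<equiv> Indet VZ"
abbreviation pw :: phase_poly where "pw \<equiv> Indet VW"

(* Derivative of f along the Hamiltonian flow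
   x' = H_y, y' = - H_x, z' = H_w, w' = - H_z. *)
definition flow_deriv :: "phase_poly \<Rightarrow> phase_poly \<Rightarrow> phase_poly" where
  "flow_deriv H f = deriv_t f
     + partial_deriv VY H * partial_deriv VX f - partial_deriv VX H * partial_deriv VY f
     + partial_deriv VW H * partial_deriv VZ f - partial_deriv VZ H * partial_deriv VW f"

definition invariant_divisor :: "phase_poly \<Rightarrow> phase_poly \<Rightarrow> bool" where
  "invariant_divisor H f \<longleftrightarrow> f dvd flow_deriv H f"

definition hamiltonian :: "complex \<Rightarrow> complex \<Rightarrow> complex \<Rightarrow> complex \<Rightarrow> phase_poly" where
  "hamiltonian \<alpha>\<^sub>0 \<alpha>\<^sub>1 \<alpha>\<^sub>2 \<alpha>\<^sub>3 =
    (let t = pt; x = px; y = py; z = pz; w = pw;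
         a0 = cnst \<alpha>\<^sub>0; a1 = cnst \<alpha>\<^sub>1; a2 = cnst \<alpha>\<^sub>2; a3 = cnst \<alpha>\<^sub>3
     in Const (1 / t_fun ^ 2) *
       (- t * x * (x - 1) * y ^ 2 + (x ^ 2 + ((a0 + a1) * t - 1) * x - a1 * t) * y
        + (a2 + a3) * x - (a0 * t - 1) * a1
        - cnst (1/4) * z ^ 2 * w ^ 4 + cnst (1/2) * a3 * z * w ^ 3
        + cnst (1/4) * (2 * t * z ^ 2 - a3 ^ 2) * w ^ 2
        - cnst (1/2) * ((a0 + a1 + 2 * a2 + 2 * a3) * t - 1) * z * w
        - cnst (1/4) * t ^ 2 * z ^ 2
        - x * z * w))"

end

theory Submission
  imports Defs
begin

text \<open>
  The derivative along the flow is a derivation of the ring C(t)[x,y,z,w], so it is determined by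
  the values on t, x, y, z, w that Hamilton's equations prescribe. On each hypersurface
  f = 0 the derivative of f turns out to be a multiple of one parameter:
  \<^item> on x = 1 it is \<open>\<alpha>\<^sub>0 / t\<close>;
  \<^item> on x = 0 it is \<open>- \<alpha>\<^sub>1 / t\<close>;
  \<^item> on z = 0 it is \<open>- \<alpha>\<^sub>3\<^sup>2 w / (2 t\<^sup>2)\<close>;
  \<^item> on \<open>y w\<^sup>2 - t y + 1 = 0\<close> it is \<open>- \<alpha>\<^sub>2 (w\<^sup>2 + t) / t\<^sup>2\<close>, by the normalization
    \<open>\<alpha>\<^sub>0 + \<alpha>\<^sub>1 + 2 \<alpha>\<^sub>2 + \<alpha>\<^sub>3 = 1\<close>.

  When that parameter is 0, division by f therefore leaves no remainder, and the quotient is an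
  explicit cofactor. For the last divisor, the quotient is found by putting \<open>u = w\<^sup>2 - t\<close> and
  replacing each product \<open>y u\<close> by \<open>f - 1\<close>: the terms without f cancel.

  What has to be established is that the operators defined by sums over monomials satisfy the
  Leibniz rule. Both kinds (\<open>partial_deriv\<close>, which lowers an exponent, and \<open>deriv_t\<close>, which
  differentiates coefficients) are additive, so it is enough to look at products of two
  monomials (\<open>derivation_if_leibniz_single\<close>). After that, everything is calculation
  with the rules of differentiation (\<open>partial_deriv_hamiltonian\<close>).
\<close>

section \<open>Derivations of a commutative ring\<close>

locale derivation = additive D for D :: "'a::comm_ring_1 \<Rightarrow> 'a" +
  assumes leibniz: "D (x * y) = D x * y + x * D y"
begin

lemma one [simp]: "D 1 = 0"
  using leibniz[of 1 1] by simp

lemma of_nat [simp]: "D (of_nat n) = 0"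
  by (induction n) (simp_all add: add zero)

lemma numeral [simp]: "D (numeral k) = 0"
  using of_nat[of "numeral k"] by simp

lemma power_Suc: "D (x ^ Suc n) = of_nat (Suc n) * x ^ n * D x"
  by (induction n) (simp_all add: leibniz algebra_simps)

lemma power_numeral: "D (x ^ numeral k) = numeral k * x ^ pred_numeral k * D x"
  by (metis power_Suc numeral_eq_Suc of_nat_numeral)

lemmas rules = add diff minus zero leibniz power_numeral

end

section \<open>Operators defined monomial by monomial\<close>

lemma poly_mapping_eq_sum_single:
  fixes p :: "'m \<Rightarrow>\<^sub>0 'a::comm_monoid_add"
  shows "p = (\<Sum>m\<in>Poly_Mapping.keys p. Poly_Mapping.single m (Poly_Mapping.lookup p m))"
proof (rule poly_mapping_eqI)
  fix k
  show "Poly_Mapping.lookup p k = Poly_Mapping.lookup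
    (\<Sum>m\<in>Poly_Mapping.keys p. Poly_Mapping.single m (Poly_Mapping.lookup p m)) k"
    by (cases "k \<in> Poly_Mapping.keys p")
      (auto simp: lookup_sum lookup_single when_def sum.delta in_keys_iff)
qed

text \<open>
  Cancellation may make the support of a sum smaller than the union of the supports. The
  additional terms vanish because an additive map sends the coefficient 0 to 0, so all three
  sums may be taken over the union.
\<close>

lemma additive_sum_keys:
  fixes g :: "'m \<Rightarrow> 'a::ab_group_add \<Rightarrow> 'b::ab_group_add"
  assumes "\<And>m. additive (g m)"
  shows "additive (\<lambda>p. \<Sum>m\<in>Poly_Mapping.keys p. g m (Poly_Mapping.lookup p m))"
proof
  fix p q :: "'m \<Rightarrow>\<^sub>0 'a"
  let ?A = "Poly_Mapping.keys p \<union> Poly_Mapping.keys q"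
  have extend: "(\<Sum>m\<in>Poly_Mapping.keys r. g m (Poly_Mapping.lookup r m))
      = (\<Sum>m\<in>?A. g m (Poly_Mapping.lookup r m))" if "Poly_Mapping.keys r \<subseteq> ?A" for r
    using that by (intro sum.mono_neutral_left)
      (auto simp: in_keys_iff additive.zero[OF assms])
  have "(\<Sum>m\<in>Poly_Mapping.keys (p + q). g m (Poly_Mapping.lookup (p + q) m))
      = (\<Sum>m\<in>?A. g m (Poly_Mapping.lookup (p + q) m))"
    by (rule extend) (rule keys_add)
  then show "(\<Sum>m\<in>Poly_Mapping.keys (p + q). g m (Poly_Mapping.lookup (p + q) m))
      = (\<Sum>m\<in>Poly_Mapping.keys p. g m (Poly_Mapping.lookup p m))
      + (\<Sum>m\<in>Poly_Mapping.keys q. g m (Poly_Mapping.lookup q m))"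
    by (simp add: extend lookup_add additive.add[OF assms] sum.distrib)
qed

text \<open>
  Both sides of the Leibniz rule are biadditive, and every polynomial is a sum of monomials.
\<close>

lemma derivation_if_leibniz_single:
  fixes D :: "('m::comm_monoid_add \<Rightarrow>\<^sub>0 'a::comm_ring_1) \<Rightarrow> ('m \<Rightarrow>\<^sub>0 'a)"
  assumes "additive D"
    and single: "\<And>m n a b. D (Poly_Mapping.single m a * Poly_Mapping.single n b)
      = D (Poly_Mapping.single m a) * Poly_Mapping.single n b
        + Poly_Mapping.single m a * D (Poly_Mapping.single n b)"
  shows "derivation D"
proof -
  interpret additive D by fact
  show ?thesis
  proof
    fix p q :: "'m \<Rightarrow>\<^sub>0 'a"
    define P where "P = Poly_Mapping.keys p"
    define Q where "Q = Poly_Mapping.keys q"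
    define u where "u m = Poly_Mapping.single m (Poly_Mapping.lookup p m)" for m
    define v where "v n = Poly_Mapping.single n (Poly_Mapping.lookup q n)" for n
    have p: "p = sum u P" and q: "q = sum v Q"
      unfolding P_def Q_def u_def v_def by (rule poly_mapping_eq_sum_single)+
    have "D (p * q) = (\<Sum>m\<in>P. \<Sum>n\<in>Q. D (u m * v n))"
      by (simp add: p q sum_product sum)
    also have "\<dots> = (\<Sum>m\<in>P. \<Sum>n\<in>Q. D (u m) * v n + u m * D (v n))"
      by (simp add: u_def v_def single)
    also have "\<dots> = D p * q + p * D q"
      by (simp add: p q sum_product sum sum.distrib)
    finally show "D (p * q) = D p * q + p * D q" .
  qed
qed

section \<open>The partial derivatives\<close>

lemma additive_partial_deriv:
  "additive (partial_deriv v :: ('v, 'a::comm_ring_1) mpoly \<Rightarrow> _)"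
  unfolding partial_deriv_def
  by (rule additive_sum_keys) (standard, simp add: single_add algebra_simps)

lemma partial_deriv_single:
  "partial_deriv v (Poly_Mapping.single m a)
    = Poly_Mapping.single (m - Poly_Mapping.single v 1) (of_nat (Poly_Mapping.lookup m v) * a)"
  by (simp add: partial_deriv_def)

lemma derivation_partial_deriv:
  "derivation (partial_deriv v :: ('v, 'a::comm_ring_1) mpoly \<Rightarrow> _)"
proof (rule derivation_if_leibniz_single[OF additive_partial_deriv])
  fix m n :: "'v \<Rightarrow>\<^sub>0 nat" and a b :: 'a
  let ?e = "Poly_Mapping.single v (1::nat)"
  \<comment> \<open>Exponent subtraction truncates, so the shift of exponents needs v to occur in m; if it
    does not, the coefficient is 0 and there is nothing to shift.\<close>
  have shift: "(m - ?e) + n = m + n - ?e" if "Poly_Mapping.lookup m v \<noteq> 0" for m n :: "'v \<Rightarrow>\<^sub>0 nat"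
    using that by (intro poly_mapping_eqI)
      (auto simp: lookup_add lookup_minus lookup_single when_def)
  have left: "Poly_Mapping.single ((m - ?e) + n) (of_nat (Poly_Mapping.lookup m v) * (a * b))
      = Poly_Mapping.single (m + n - ?e) (of_nat (Poly_Mapping.lookup m v) * (a * b))"
    by (cases "Poly_Mapping.lookup m v = 0") (simp_all add: shift[simplified])
  have right: "Poly_Mapping.single (m + (n - ?e)) (of_nat (Poly_Mapping.lookup n v) * (a * b))
      = Poly_Mapping.single (m + n - ?e) (of_nat (Poly_Mapping.lookup n v) * (a * b))"
    using shift[of n m, simplified]
    by (cases "Poly_Mapping.lookup n v = 0") (simp_all add: add.commute)
  show "partial_deriv v (Poly_Mapping.single m a * Poly_Mapping.single n b)
      = partial_deriv v (Poly_Mapping.single m a) * Poly_Mapping.single n b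
        + Poly_Mapping.single m a * partial_deriv v (Poly_Mapping.single n b)"
    using left right
    by (simp add: partial_deriv_single mult_single lookup_add ring_distribs single_add
        mult.assoc mult.left_commute)
qed

interpretation partial: derivation "partial_deriv v :: ('v, 'a::comm_ring_1) mpoly \<Rightarrow> _" for v
  by (rule derivation_partial_deriv)

lemma partial_deriv_Const [simp]: "partial_deriv v (Const a) = 0"
  by (simp add: Const_def partial_deriv_single)

lemma partial_deriv_Indet:
  "partial_deriv v (Indet u :: ('v, 'a::comm_ring_1) mpoly) = (if u = v then 1 else 0)"
  by (simp add: Indet_def partial_deriv_single lookup_single)

section \<open>The derivative with respect to time\<close>

interpretation fract: derivation fract_deriv
proof
  fix p q :: ratfun
  obtain a b c d where [simp]: "p = Fract a b" "q = Fract c d" "b \<noteq> 0" "d \<noteq> 0"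
    by (metis Fract_cases)
  show "fract_deriv (p + q) = fract_deriv p + fract_deriv q"
    by (simp add: fract_deriv_Fract eq_fract pderiv_mult pderiv_add algebra_simps power2_eq_square)
  show "fract_deriv (p * q) = fract_deriv p * q + p * fract_deriv q"
    by (simp add: fract_deriv_Fract eq_fract pderiv_mult algebra_simps power2_eq_square)
qed

lemma deriv_t_single:
  "deriv_t (Poly_Mapping.single m a) = Poly_Mapping.single m (fract_deriv a)"
  by (simp add: deriv_t_def fract.zero)

interpretation deriv_t: derivation deriv_t
proof (rule derivation_if_leibniz_single)
  show "additive deriv_t"
    unfolding deriv_t_def
    by (rule additive_sum_keys) (standard, simp add: fract.add single_add)
qed (simp add: deriv_t_single mult_single fract.leibniz single_add)

lemma deriv_t_Indet [simp]: "deriv_t (Indet v) = 0"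
  by (simp add: Indet_def deriv_t_single)

lemma deriv_t_pt [simp]: "deriv_t pt = 1"
proof -
  have "fract_deriv t_fun = 1"
    by (simp add: t_fun_def to_fract_def fract_deriv_Fract pderiv_pCons One_fract_def flip: one_pCons)
  then show ?thesis
    by (simp add: Const_def deriv_t_single)
qed

section \<open>Hamilton's equations\<close>

interpretation flow: derivation "flow_deriv H" for H
  by standard
    (simp_all add: flow_deriv_def deriv_t.rules partial.rules algebra_simps)

text \<open>
  By the rules for derivations, these five values determine the flow derivative of every
  polynomial in t, x, y, z, w with integer coefficients, such as the four divisors.
\<close>

lemma flow_deriv_coordinates:
  "flow_deriv H pt = 1"
  "flow_deriv H px = partial_deriv VY H"
  "flow_deriv H py = - partial_deriv VX H"
  "flow_deriv H pz = partial_deriv VW H"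
  "flow_deriv H pw = - partial_deriv VZ H"
  by (simp_all add: flow_deriv_def partial_deriv_Indet)

lemma cnst_add: "cnst (a + b) = cnst a + cnst b"
  by (simp add: cnst_def Const_def flip: single_add to_fract_add)

lemma cnst_0 [simp]: "cnst 0 = 0"
  by (simp add: cnst_def Const_def)

lemma cnst_1 [simp]: "cnst 1 = 1"
  by (simp add: cnst_def Const_def flip: one_pCons)

lemma partial_deriv_cnst [simp]: "partial_deriv v (cnst a) = 0"
  by (simp add: cnst_def)

text \<open>
  The factors 1/2 and 1/4 of the Hamiltonian enter the calculations below only through these
  two relations, since the polynomials form a ring without division.
\<close>

lemma cnst_half: "2 * cnst (1/2) = 1"
proof -
  have "cnst (1/2) + cnst (1/2) = cnst (1/2 + 1/2)"
    by (rule cnst_add [symmetric])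
  then show ?thesis by simp
qed

lemma cnst_quarter: "2 * cnst (1/4) = cnst (1/2)"
proof -
  have "cnst (1/4) + cnst (1/4) = cnst (1/4 + 1/4)"
    by (rule cnst_add [symmetric])
  then show ?thesis by simp
qed

text \<open>
  The derivatives are arranged to show what the divisors need: z is a factor of all terms of the
  last one that do not contain \<open>\<alpha>\<^sub>3\<close>, and the powers of \<open>w\<^sup>2 - t\<close> are those that meet
  \<open>f = y (w\<^sup>2 - t) + 1\<close>.
\<close>

lemma partial_deriv_hamiltonian:
  fixes \<alpha>\<^sub>0 \<alpha>\<^sub>1 \<alpha>\<^sub>2 \<alpha>\<^sub>3 :: complex
  fixes c t x y z w a0 a1 a2 a3 h H :: phase_poly
  defines "c \<equiv> Const (1 / t_fun ^ 2)" and "t \<equiv> pt"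
    and "x \<equiv> px" and "y \<equiv> py" and "z \<equiv> pz" and "w \<equiv> pw"
    and "a0 \<equiv> cnst \<alpha>\<^sub>0" and "a1 \<equiv> cnst \<alpha>\<^sub>1" and "a2 \<equiv> cnst \<alpha>\<^sub>2" and "a3 \<equiv> cnst \<alpha>\<^sub>3"
    and "h \<equiv> cnst (1/2)"
    and "H \<equiv> hamiltonian \<alpha>\<^sub>0 \<alpha>\<^sub>1 \<alpha>\<^sub>2 \<alpha>\<^sub>3"
  shows
    "partial_deriv VX H = c * (t * (1 - 2 * x) * y ^ 2 + (2 * x + (a0 + a1) * t - 1) * y
      + a2 + a3 - z * w)" (is ?X)
    and "partial_deriv VY H = c * (2 * t * x * (1 - x) * y + x ^ 2 + ((a0 + a1) * t - 1) * x
      - a1 * t)" (is ?Y)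
    and "partial_deriv VZ H = c * (h * a3 * w ^ 3 - h * z * (w ^ 2 - t) ^ 2
      - h * ((a0 + a1 + 2 * a2 + 2 * a3) * t - 1) * w - x * w)" (is ?Z)
    and "partial_deriv VW H = c * (2 * h * z ^ 2 * w * (t - w ^ 2) + 3 * h * a3 * z * w ^ 2
      - h * a3 ^ 2 * w - h * ((a0 + a1 + 2 * a2 + 2 * a3) * t - 1) * z - x * z)" (is ?W)
proof -
  define q where "q = cnst (1/4)"
  have h: "h = 2 * q"
    unfolding h_def q_def by (rule cnst_quarter [symmetric])
  note definitions = H_def c_def t_def x_def y_def z_def w_def
    a0_def a1_def a2_def a3_def h_def q_def
  have constants: "partial_deriv v t = 0" "partial_deriv v c = 0"
    "partial_deriv v h = 0" "partial_deriv v q = 0"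
    "partial_deriv v a0 = 0" "partial_deriv v a1 = 0"
    "partial_deriv v a2 = 0" "partial_deriv v a3 = 0" for v
    unfolding definitions by simp_all
  have coordinates: "partial_deriv v x = (if v = VX then 1 else 0)"
    "partial_deriv v y = (if v = VY then 1 else 0)"
    "partial_deriv v z = (if v = VZ then 1 else 0)"
    "partial_deriv v w = (if v = VW then 1 else 0)" for v
    unfolding definitions by (auto simp: partial_deriv_Indet)
  have H: "H = c * (- t * x * (x - 1) * y ^ 2 + (x ^ 2 + ((a0 + a1) * t - 1) * x - a1 * t) * y
        + (a2 + a3) * x - (a0 * t - 1) * a1
        - q * z ^ 2 * w ^ 4 + h * a3 * z * w ^ 3
        + q * (2 * t * z ^ 2 - a3 ^ 2) * w ^ 2
        - h * ((a0 + a1 + 2 * a2 + 2 * a3) * t - 1) * z * w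
        - q * t ^ 2 * z ^ 2
        - x * z * w)"
    by (simp add: definitions hamiltonian_def Let_def)
  note differentiate = H partial.rules constants coordinates
  note expand = algebra_simps power2_eq_square power3_eq_cube power4_eq_xxxx
  show ?X by (simp add: differentiate) (simp add: expand)
  show ?Y by (simp add: differentiate) (simp add: expand)
  show ?Z by (simp add: differentiate) (simp add: expand h)
  show ?W by (simp add: differentiate) (simp add: expand h)
qed

theorem proposition4p3:
  fixes \<alpha>\<^sub>0 \<alpha>\<^sub>1 \<alpha>\<^sub>2 \<alpha>\<^sub>3 :: complex
  assumes "\<alpha>\<^sub>0 + \<alpha>\<^sub>1 + 2 * \<alpha>\<^sub>2 + \<alpha>\<^sub>3 = 1"
  defines "H \<equiv> hamiltonian \<alpha>\<^sub>0 \<alpha>\<^sub>1 \<alpha>\<^sub>2 \<alpha>\<^sub>3"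
  shows "(\<alpha>\<^sub>0 = 0 \<longrightarrow> invariant_divisor H (px - 1)) \<and>
         (\<alpha>\<^sub>1 = 0 \<longrightarrow> invariant_divisor H px) \<and>
         (\<alpha>\<^sub>2 = 0 \<longrightarrow> invariant_divisor H (py * pw ^ 2 - pt * py + 1)) \<and>
         (\<alpha>\<^sub>3 = 0 \<longrightarrow> invariant_divisor H pz)"
proof (intro conjI impI)
  define c :: phase_poly where "c = Const (1 / t_fun ^ 2)"
  define t x y z w where "t = pt" and "x = px" and "y = py" and "z = pz" and "w = pw"
  define a0 a1 a2 a3 h where "a0 = cnst \<alpha>\<^sub>0" and "a1 = cnst \<alpha>\<^sub>1" and "a2 = cnst \<alpha>\<^sub>2"
    and "a3 = cnst \<alpha>\<^sub>3" and "h = cnst (1/2)"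
  note definitions = c_def t_def x_def y_def z_def w_def a0_def a1_def a2_def a3_def h_def H_def
  note hamilton = partial_deriv_hamiltonian[of \<alpha>\<^sub>0 \<alpha>\<^sub>1 \<alpha>\<^sub>2 \<alpha>\<^sub>3, folded definitions]
  note coordinates = flow_deriv_coordinates[of H, folded definitions, unfolded hamilton]

  show "invariant_divisor H (px - 1)" if "\<alpha>\<^sub>0 = 0"
  proof -
    have "a0 = 0" using that by (simp add: a0_def)
    then have "flow_deriv H (x - 1) = (x - 1) * (c * (x - 2 * t * x * y + a1 * t))"
      by (simp add: flow.rules coordinates algebra_simps power2_eq_square power3_eq_cube)
    then show ?thesis
      unfolding invariant_divisor_def x_def by (rule dvdI)
  qed

  show "invariant_divisor H px" if "\<alpha>\<^sub>1 = 0"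
  proof -
    have "a1 = 0" using that by (simp add: a1_def)
    then have "flow_deriv H x = x * (c * (2 * t * (1 - x) * y + x + a0 * t - 1))"
      by (simp add: flow.rules coordinates algebra_simps power2_eq_square power3_eq_cube)
    then show ?thesis
      unfolding invariant_divisor_def x_def by (rule dvdI)
  qed

  show "invariant_divisor H pz" if "\<alpha>\<^sub>3 = 0"
  proof -
    have "a3 = 0" using that by (simp add: a3_def)
    then have "flow_deriv H z = z * (c * (2 * h * z * w * (t - w ^ 2)
        - h * ((a0 + a1 + 2 * a2) * t - 1) - x))"
      by (simp add: flow.rules coordinates algebra_simps power2_eq_square power3_eq_cube)
    then show ?thesis
      unfolding invariant_divisor_def z_def by (rule dvdI)
  qed

  show "invariant_divisor H (py * pw ^ 2 - pt * py + 1)" if "\<alpha>\<^sub>2 = 0"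
  proof -
    have a2: "a2 = 0" using that by (simp add: a2_def)
    \<comment> \<open>The normalization eliminates the parameter with index 0.\<close>
    have "cnst (\<alpha>\<^sub>0 + \<alpha>\<^sub>1 + \<alpha>\<^sub>3) = cnst 1"
      using assms(1) that by simp
    then have a: "a0 = 1 - a1 - a3"
      unfolding definitions by (simp add: cnst_add algebra_simps)
    have h: "2 * h = 1"
      unfolding h_def by (rule cnst_half)
    have "t_fun \<noteq> 0" by (simp add: t_fun_def)
    then have c: "c * t ^ 2 = 1"
      by (simp add: c_def t_def Const_def mult_single power2_eq_square)
    \<comment> \<open>The divisor has degree 2 in w, so its derivative contains that of w with a factor 2,
      which absorbs the factor 1/2 in the equation for w.\<close>
    have "2 * flow_deriv H w = c * ((2 * h) * (z * (w ^ 2 - t) ^ 2 - a3 * w ^ 3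
        + ((a0 + a1 + 2 * a2 + 2 * a3) * t - 1) * w) + 2 * x * w)"
      by (simp add: coordinates algebra_simps)
    then have w: "2 * flow_deriv H w = c * (z * (w ^ 2 - t) ^ 2 - a3 * w ^ 3
        + ((a3 + 1) * t - 1) * w + 2 * x * w)"
      by (simp add: h a a2)
    \<comment> \<open>The explicit dependence of the divisor on t contributes the term y, taken with sign -1.
      It is written as the multiple c * t ^ 2 * y of c so that c becomes a common factor.\<close>
    have "flow_deriv H (y * w ^ 2 - t * y + 1)
        = (w ^ 2 - t) * flow_deriv H y + y * w * (2 * flow_deriv H w) - c * t ^ 2 * y"
      by (simp add: flow.rules coordinates(1) c) (simp add: algebra_simps)
    also have "\<dots> = (y * w ^ 2 - t * y + 1)
        * (c * ((z * w - a3) * (w ^ 2 - t) + t * (2 * x - 1) * y))"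
      unfolding w coordinates(3) a
      by (simp add: a2 algebra_simps power2_eq_square power3_eq_cube)
    finally show ?thesis
      unfolding invariant_divisor_def t_def y_def w_def by (rule dvdI)
  qed
qed

end
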